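(* Let $N\ge 2$ be an integer. For a random variable $X_\infty$ with support $\{1,\dots,N\}$, write $\pi_{(N)}(k)=\mathbf{P}(X_\infty=k)>0$, $k=1,\dots,N$, $\Phi_\infty(z)=\sum_{k=1}^N\pi_{(N)}(k)z^k=z\Psi_\infty(z)$, and let $\nu_{(N)}$ be the random variable with support $\{1,\dots,N\}$ whose distribution function satisfies $\mathbf{P}(X_\infty\le j)=\Phi_\infty(\mathbf{P}(\nu_{(N)}\le j))$, $j=1,\dots,N$. Then the mapping $X_\infty\to\nu_{(N)}$ (of laws with support $\{1,\dots,N\}$ to laws with support $\{1,\dots,N\}$) is one-to-one and onto. Moreover, with $C^{(N-1)}_{n-1,0}=\delta_{n-1,0}$ and $$C^{(N-1)}_{n-1,k}=\sum{}^{*}\prod_{m=1}^{N-1}\frac{\left(\pi_{(N)}(m+1)/\pi_{(N)}(1)\right)^{k_m}}{k_m!},$$ where $\sum^*$ runs over integers $k_m\ge0$, $m=1,\dots,N-1$, with $\sum_{m=1}^{N-1}k_m=k$ and $\sum_{m=1}^{N-1}mk_m=n-1\ge k$, one has $$\varphi_n:=[z^n]\Phi_\infty^{-1}(z)=\frac1n[z^{n-1}]\Psi_\infty(z)^{-n}=\frac{\pi_{(N)}(1)^{-n}}{n}\sum_{k=0}^{n-1}(-1)^k[n]_k\,C^{(N-1)}_{n-1,k}.$$ So, with $h_1=1$ and $h_n=\frac1n\sum_{k=1}^{n-1}(-1)^k[n]_kC^{(N-1)}_{n-1,k}$, $n\ge2$, $$\mathbf{P}(\nu_{(N)}\le j)=\sum_{n\ge1}h_n\left(\mathbf{P}(X_\infty\le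 j)/\pi_{(N)}(1)\right)^n$$ is the distribution function of $\nu_{(N)}$ associated to any $\mathbf{P}(X_\infty\le j)=\sum_{k=1}^j\pi_{(N)}(k)$, $j=1,\dots,N$, obeying $\mathbf{P}(X_\infty\le N)=1$.
   Context: $[n]_k=n(n+1)\cdots(n+k-1)$ is the rising factorial, $\delta_{a,b}$ the Kronecker symbol, $[z^n]$ denotes extraction of the coefficient of $z^n$, and $\Phi_\infty^{-1}$ is the inverse of $\Phi_\infty$ (vanishing at $0$). The functional equation $\mathbf{P}(X_\infty\le j)=\Phi_\infty(\mathbf{P}(\nu_{(N)}\le j))$ expresses that the law of $X_\infty$ is the invariant probability measure of the Lamperti maximal branching process $X_{n+1}=\max_{j=1,\dots,X_n}\nu_{j,n+1}$ with the $\nu_{j,n+1}$ i.i.d. copies of $\nu_{(N)}$.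
   Formalization: The series for P(ν≤j) can diverge (e.g. N=2, π(1)=π(2)=1/2, j=1), so the final formula is stated literally only when the series converges; for all laws and j it is stated as the analytic continuation of the series from 0 along the segment to P(X≤j)/π(1). *)

theory Defs
  imports
    "HOL-Probability.Probability"
    "HOL-Complex_Analysis.Complex_Analysis"
    "HOL-Computational_Algebra.Computational_Algebra"
begin

definition laws :: "nat \<Rightarrow> nat pmf set" where
  "laws N = {p. set_pmf p = {1..N}}"

definition dist_fun :: "nat pmf \<Rightarrow> nat \<Rightarrow> real" where
  "dist_fun p j = measure_pmf.prob p {..j}"

definition Phi :: "nat \<Rightarrow> nat pmf \<Rightarrow> real poly" where
  "Phi N p = (\<Sum>k=1..N. monom (pmf p k) k)"

definition Psi :: "nat \<Rightarrow> nat pmf \<Rightarrow> real poly" where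
  "Psi N p = (\<Sum>k=1..N. monom (pmf p k) (k - 1))"

lemma Phi_eq_X_times_Psi: "Phi N p = [:0, 1:] * Psi N p"
proof -
  have "[:0, 1:] * Psi N p = (\<Sum>k=1..N. [:0, 1:] * monom (pmf p k) (k - 1))"
    by (simp add: Psi_def sum_distrib_left)
  also have "\<dots> = Phi N p"
    unfolding Phi_def
  proof (rule sum.cong)
    fix k assume "k \<in> {1..N}"
    then show "[:0, 1:] * monom (pmf p k) (k - 1) = monom (pmf p k) k"
      by (cases k) (auto simp: monom_Suc)
  qed simp
  finally show ?thesis by simp
qed

definition nu_of :: "nat \<Rightarrow> nat pmf \<Rightarrow> nat pmf \<Rightarrow> bool" where
  "nu_of N p q \<longleftrightarrow> (\<forall>j\<in>{1..N}. dist_fun p j = poly (Phi N p) (dist_fun q j))"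

definition nu_law :: "nat \<Rightarrow> nat pmf \<Rightarrow> nat pmf" where
  "nu_law N p = (THE q. q \<in> laws N \<and> nu_of N p q)"

text \<open>
  In \<open>C_coeff p M a k\<close> (with \<open>M = N - 1\<close> and \<open>a = n - 1\<close> in the application), a family
  of nonnegative integers \<open>k\<^sub>1, \<dots>, k\<^sub>M\<close> is an extensional function on \<open>{1..M}\<close>, so
  that each family is counted once and the index set is finite.
\<close>

definition C_index :: "nat \<Rightarrow> nat \<Rightarrow> nat \<Rightarrow> (nat \<Rightarrow> nat) set" where
  "C_index M a k =
    {\<kappa> \<in> {1..M} \<rightarrow>\<^sub>E UNIV. (\<Sum>m=1..M. \<kappa> m) = k \<and> (\<Sum>m=1..M. m * \<kappa> m) = a \<and> k \<le> a}"

lemma finite_C_index: "finite (C_index M a k)"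
proof (rule finite_subset)
  show "C_index M a k \<subseteq> {1..M} \<rightarrow>\<^sub>E {..k}"
  proof
    fix \<kappa> assume \<kappa>: "\<kappa> \<in> C_index M a k"
    have "\<kappa> m \<le> k" if "m \<in> {1..M}" for m
      using \<kappa> member_le_sum[of m "{1..M}" \<kappa>] that by (auto simp: C_index_def)
    with \<kappa> show "\<kappa> \<in> {1..M} \<rightarrow>\<^sub>E {..k}"
      by (auto simp: C_index_def PiE_def)
  qed
qed (auto intro: finite_PiE)

definition C_coeff :: "nat pmf \<Rightarrow> nat \<Rightarrow> nat \<Rightarrow> nat \<Rightarrow> real" where
  "C_coeff p M a k =
    (if k = 0 then of_bool (a = 0)
     else \<Sum>\<kappa>\<in>C_index M a k. \<Prod>m=1..M. (pmf p (m + 1) / pmf p 1) ^ \<kappa> m / fact (\<kappa> m))"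

definition h_coeff :: "nat \<Rightarrow> nat pmf \<Rightarrow> nat \<Rightarrow> real" where
  "h_coeff N p n =
    (if n = 0 then 0
     else if n = 1 then 1
     else 1 / real n *
       (\<Sum>k=1..n-1. (-1) ^ k * pochhammer (real n) k * C_coeff p (N - 1) (n - 1) k))"

text \<open>
  The power series of \<open>\<Phi>\<^sup>-\<^sup>1\<close> at \<open>0\<close> need not converge at the points of
  \<open>]0, 1]\<close>, as the next lemma shows. Its sum at a real point \<open>x\<close> is therefore also taken
  in the sense of analytic continuation of the germ at \<open>0\<close> along the segment from \<open>0\<close>
  to \<open>x\<close>; \<open>continued_sum_unique\<close> and \<open>continued_sum_in_disc\<close> show that this
  determines the value and that it is the ordinary sum inside the disc of convergence.
\<close>

lemma not_summable_h_coeff: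
  assumes "p \<in> laws 2" "pmf p 1 = pmf p 2"
  shows "\<not> summable (\<lambda>n. h_coeff 2 p (Suc n) * (dist_fun p 1 / pmf p 1) ^ Suc n)"
proof -
  have sup: "set_pmf p = {1..2}"
    using assms(1) by (simp add: laws_def)
  then have p1: "pmf p 1 \<noteq> 0"
    by (simp flip: set_pmf_iff)
  have "pmf p 0 = 0"
    using sup by (simp flip: set_pmf_iff add: pmf_eq_0_set_pmf)
  then have "dist_fun p 1 = pmf p 1"
    by (simp add: dist_fun_def measure_measure_pmf_finite atMost_Suc)
  then have x: "dist_fun p 1 / pmf p 1 = 1"
    using p1 by simp
  have ratio: "pmf p (1 + 1) / pmf p 1 = 1"
    using assms(2) p1 by (simp add: numeral_2_eq_2)
  have C: "C_coeff p (2 - 1) m k = (if k = m then 1 / fact m else 0)" for m k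
  proof (cases "k = 0")
    case False
    have "C_index 1 m k = (if k = m then {\<lambda>i\<in>{Suc 0}. m} else {})"
      by (auto simp: C_index_def fun_eq_iff PiE_def extensional_def)
    then show ?thesis
      using False ratio by (simp add: C_coeff_def)
  qed (auto simp: C_coeff_def)
  have h: "h_coeff 2 p (Suc n) = (-1) ^ n * (pochhammer (real (Suc n)) n / (real (Suc n) * fact n))" for n
  proof (cases n)
    case (Suc m)
    have "h_coeff 2 p (Suc n) = 1 / real (Suc n) *
       (\<Sum>k=1..n. if k = n then (-1) ^ k * pochhammer (real (Suc n)) k * (1 / fact n) else 0)"
      unfolding h_coeff_def C using Suc by (auto intro!: sum.cong)
    then show ?thesis using Suc by simp
  qed (simp add: h_coeff_def)
  have ge: "1 \<le> pochhammer (real (Suc n)) n / (real (Suc n) * fact n)" for n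
  proof (cases n)
    case (Suc m)
    have "pochhammer (1 + 1 :: real) m \<le> pochhammer (real (Suc n) + 1) m"
      unfolding pochhammer_prod by (intro prod_mono) auto
    moreover have "pochhammer (1 + 1 :: real) m = fact n"
      using pochhammer_rec[of "1 :: real" m] Suc by (simp add: pochhammer_fact)
    ultimately have "real (Suc n) * fact n \<le> pochhammer (real (Suc n)) n"
      by (simp add: Suc pochhammer_rec mult_left_mono)
    then show ?thesis by simp
  qed simp
  show ?thesis
    unfolding x
  proof
    assume "summable (\<lambda>n. h_coeff 2 p (Suc n) * 1 ^ Suc n)"
    then have "(\<lambda>n. \<bar>h_coeff 2 p (Suc n)\<bar>) \<longlonglongrightarrow> 0"
      using summable_LIMSEQ_zero tendsto_rabs_zero by fastforce
    moreover have "1 \<le> \<bar>h_coeff 2 p (Suc n)\<bar>" for n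
      using ge[of n] by (simp only: h abs_mult power_abs) simp
    ultimately show False
      using LIMSEQ_le_const[of _ 0 1] by fastforce
  qed
qed

definition continued_sum :: "(nat \<Rightarrow> real) \<Rightarrow> real \<Rightarrow> real \<Rightarrow> bool" where
  "continued_sum c x s \<longleftrightarrow>
    (\<exists>g :: complex \<Rightarrow> complex.
       g has_fps_expansion Abs_fps (\<lambda>n. of_real (c n)) \<and>
       g analytic_on (of_real ` closed_segment 0 x) \<and>
       g (of_real x) = of_real s)"

lemma continued_sum_unique:
  assumes "continued_sum c x s" "continued_sum c x t"
  shows "s = t"
proof -
  define S :: "complex set" where "S = of_real ` closed_segment 0 x"
  obtain f where f: "f has_fps_expansion Abs_fps (\<lambda>n. of_real (c n))"
      "f analytic_on S" "f (of_real x) = of_real s"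
    using assms(1) unfolding continued_sum_def S_def by blast
  obtain g where g: "g has_fps_expansion Abs_fps (\<lambda>n. of_real (c n))"
      "g analytic_on S" "g (of_real x) = of_real t"
    using assms(2) unfolding continued_sum_def S_def by blast
  define d where "d = (\<lambda>z. f z - g z)"
  have "d analytic_on S"
    unfolding d_def using f(2) g(2) by (rule analytic_on_diff)
  then obtain A where A: "open A" "S \<subseteq> A" "d holomorphic_on A"
    by (auto simp: analytic_on_holomorphic)
  have S: "0 \<in> S" "of_real x \<in> S"
    unfolding S_def using of_real_0 ends_in_segment by (metis imageI, blast)
  have conn: "connected S"
    unfolding S_def by (rule connected_continuous_image) (auto intro!: continuous_intros)
  have sub: "S \<subseteq> connected_component_set A 0"
    using S conn A by (intro connected_component_maximal) auto
  have "d (of_real x) = 0"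
  proof (rule has_fps_expansion_0_analytic_continuation
      [where f = d and A = "connected_component_set A 0"])
    show "d has_fps_expansion 0"
      using has_fps_expansion_diff[OF f(1) g(1)] by (simp add: d_def)
    show "d holomorphic_on connected_component_set A 0"
      using A(3) connected_component_subset by (rule holomorphic_on_subset)
    show "open (connected_component_set A 0)"
      using A(1) by (rule open_connected_component)
  qed (use sub S in auto)
  then show ?thesis
    using f(3) g(3) by (simp add: d_def)
qed

lemma continued_sum_in_disc:
  assumes "ereal \<bar>x\<bar> < conv_radius c"
  shows "continued_sum c x (\<Sum>n. c n * x ^ n)"
proof -
  define F :: "complex fps" where "F = Abs_fps (\<lambda>n. of_real (c n))"
  have rad: "fps_conv_radius F = conv_radius c"
    unfolding fps_conv_radius_def F_def by (simp add: conv_radius_def norm_of_real)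
  have "0 \<le> ereal \<bar>x\<bar>" by simp
  then have pos: "0 < conv_radius c"
    using assms by (rule le_less_trans)
  have "summable (\<lambda>n. c n * x ^ n)"
    using assms by (intro summable_in_conv_radius) auto
  then have "(\<lambda>n. complex_of_real (c n * x ^ n)) sums of_real (\<Sum>n. c n * x ^ n)"
    by (intro sums_of_real summable_sums)
  then have val: "eval_fps F (of_real x) = of_real (\<Sum>n. c n * x ^ n)"
    by (simp add: eval_fps_def F_def sums_iff)
  have "of_real ` closed_segment 0 x \<subseteq> eball (0 :: complex) (fps_conv_radius F)"
  proof clarify
    fix u assume "u \<in> closed_segment 0 x"
    then have "\<bar>u\<bar> \<le> \<bar>x\<bar>"
      by (auto simp: closed_segment_eq_real_ivl split: if_splits)
    then have "ereal \<bar>u\<bar> < conv_radius c"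
      using assms by (meson ereal_less_eq(3) le_less_trans)
    then show "complex_of_real u \<in> eball 0 (fps_conv_radius F)"
      by (simp add: rad)
  qed
  then have "eval_fps F analytic_on of_real ` closed_segment 0 x"
    by (intro analytic_on_subset[OF _ \<open>_ \<subseteq> eball 0 _\<close>])
       (auto simp: analytic_on_open intro!: holomorphic_on_eval_fps)
  moreover have "eval_fps F has_fps_expansion F"
    using pos by (intro eval_fps_has_fps_expansion) (simp add: rad)
  ultimately show ?thesis
    unfolding continued_sum_def using val F_def by blast
qed

end

(* Let pi and F be the probabilities and the distribution function of X, and G the distribution
   function of nu. In F(j) = Phi(G(j)) the polynomial Phi increases from 0 to 1 on [0,1], so
   inverting it there yields G and hence nu. Conversely, given G, the equations
   F(j) = Phi(G(j)) say that pi is stationary for the Markov chain on {1..N} with transition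
   probabilities P(i,j) = G(j)^i - G(j-1)^i. These are positive, so the chain contracts in the
   l^1 norm and has exactly one stationary law.

   The series is Lagrange inversion plus the multinomial theorem. For its value: Re Phi' > 0 on a
   convex neighbourhood of [0,1], so Phi is injective there (Noshiro-Warschawski) and has a
   holomorphic inverse, which continues the germ at 0. When the real series happens to converge at
   the endpoint, Abel's limit theorem identifies its sum. *)

theory Submission
  imports Defs
begin

unbundle no vec_syntax

section \<open>Lagrange inversion and multinomial coefficients\<close>

text \<open>As \<open>b\<close> has no constant term, \<open>b ^ i\<close> vanishes below degree
  \<open>i\<close>, so the inner sums can all be extended to the common bound \<open>n\<close> and
  then swapped.\<close>

lemma fps_compose_mult_nth:
  fixes a b h :: "'a::comm_ring_1 fps"
  assumes "b $ 0 = 0"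
  shows "((a oo b) * h) $ n = (\<Sum>i\<le>n. a $ i * (b ^ i * h) $ n)"
proof -
  have "((a oo b) * h) $ n = (\<Sum>j\<le>n. \<Sum>i\<le>n. a $ i * (b ^ i) $ j * h $ (n - j))"
    unfolding fps_mult_nth fps_compose_nth sum_distrib_right atLeast0AtMost
    using startsby_zero_power_prefix[OF assms]
    by (intro sum.cong refl sum.mono_neutral_left) auto
  also have "\<dots> = (\<Sum>i\<le>n. \<Sum>j\<le>n. a $ i * (b ^ i) $ j * h $ (n - j))"
    by (rule sum.swap)
  finally show ?thesis
    by (simp add: fps_mult_nth sum_distrib_left mult.assoc atLeast0AtMost)
qed

text \<open>Write F = X \<psi>, Q = 1/\<psi> and G for the inverse series of F. Multiply G'(F) F' =
  1 by Q^n and read off degree n - 1: when G' is expanded in powers of F, only the power n - 1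
  contributes, and it leaves the coefficient of G' in that degree, which is n times that of G in
  degree n. Working with Q instead of 1/F avoids Laurent series.\<close>

theorem lagrange_inversion:
  fixes \<psi> :: "'a::field_char_0 fps"
  assumes \<psi>0: "\<psi> $ 0 \<noteq> 0" and n: "n > 0"
  shows "of_nat n * fps_inv (fps_X * \<psi>) $ n = (inverse \<psi> ^ n) $ (n - 1)"
proof -
  define F where "F = fps_X * \<psi>"
  define Q where "Q = inverse \<psi>"
  have F: "F $ 0 = 0" "F $ 1 \<noteq> 0"
    using \<psi>0 by (simp_all add: F_def)
  have Q\<psi>: "Q * \<psi> = 1"
    unfolding Q_def using \<psi>0 by (rule inverse_mult_eq_1)
  have F': "fps_deriv F = \<psi> + fps_X * fps_deriv \<psi>"
    by (simp add: F_def)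
  \<comment> \<open>This is the residue of \<open>F' / F ^ (m + 1)\<close>, which is an exact derivative unless \<open>m = 0\<close>.\<close>
  have coeff: "(Q ^ Suc m * fps_deriv F) $ m = (if m = 0 then 1 else 0)" for m
  proof (cases "m = 0")
    case True
    then show ?thesis
      using \<psi>0 by (simp add: F' Q_def)
  next
    case False
    have "fps_deriv (Q ^ m) = - (of_nat m * (Q ^ Suc m * fps_deriv \<psi>))"
    proof -
      obtain l where "m = Suc l"
        using False by (cases m) auto
      then show ?thesis
        unfolding Q_def fps_deriv_power' fps_inverse_deriv[OF \<psi>0]
        by (simp only: diff_Suc_1 power_Suc power2_eq_square power_0) (simp add: algebra_simps)
    qed
    then have "of_nat m * (Q ^ Suc m * fps_deriv F) =
        of_nat m * (Q ^ m * (Q * \<psi>)) - fps_X * fps_deriv (Q ^ m)"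
      by (simp add: F' algebra_simps)
    then have "of_nat m * (Q ^ Suc m * fps_deriv F) = of_nat m * Q ^ m - fps_X * fps_deriv (Q ^ m)"
      by (simp add: Q\<psi>)
    \<comment> \<open>Differentiating and multiplying by X multiplies the coefficient of degree
      \<open>m\<close> by \<open>m\<close>, so the two terms cancel there. Dividing by
      \<open>m\<close> then uses characteristic 0.\<close>
    then have "(of_nat m * (Q ^ Suc m * fps_deriv F)) $ m = 0"
      using False by (simp add: fps_mult_of_nat_nth)
    then show ?thesis
      using False by (simp add: fps_mult_of_nat_nth)
  qed
  have summand: "(F ^ i * (Q ^ n * fps_deriv F)) $ (n - 1) = (if i = n - 1 then 1 else 0)"
    if "i \<le> n - 1" for i
  proof -
    \<comment> \<open>The factor \<open>Q ^ i\<close> cancels the \<open>\<psi> ^ i\<close> in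
      \<open>F ^ i\<close>; the remaining \<open>fps_X ^ i\<close> lowers the degree to
      \<open>n - 1 - i\<close>, where \<open>coeff\<close> applies with
      \<open>m = n - 1 - i\<close>.\<close>
    have "Q ^ n = Q ^ i * Q ^ Suc (n - 1 - i)"
      unfolding power_add[symmetric] using that n by (intro arg_cong[where f = "(^) Q"]) linarith
    then have "F ^ i * (Q ^ n * fps_deriv F) =
        fps_X ^ i * ((Q * \<psi>) ^ i * (Q ^ Suc (n - 1 - i) * fps_deriv F))"
      by (simp add: F_def power_mult_distrib mult_ac)
    then show ?thesis
      using that by (simp only: Q\<psi> power_one mult_1 fps_X_power_mult_nth coeff) auto
  qed
  have "(fps_deriv (fps_inv F) oo F) * fps_deriv F = 1" 
    using fps_compose_deriv[OF F(1), of "fps_inv F"] fps_inv[OF F] by simp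
  then have "(Q ^ n) $ (n - 1) = ((fps_deriv (fps_inv F) oo F) * (Q ^ n * fps_deriv F)) $ (n - 1)"
    by (metis mult.left_commute mult.right_neutral)
  also have "\<dots> = (\<Sum>i\<le>n - 1. fps_deriv (fps_inv F) $ i * (if i = n - 1 then 1 else 0))"
    unfolding fps_compose_mult_nth[OF F(1)] by (intro sum.cong refl) (simp only: summand atMost_iff)
  also have "\<dots> = (\<Sum>i\<le>n - 1. if i = n - 1 then fps_deriv (fps_inv F) $ i else 0)"
    by (intro sum.cong) auto
  also have "\<dots> = of_nat n * fps_inv F $ n"
    using n by simp
  finally show ?thesis
    by (simp add: F_def Q_def)
qed

text \<open>Division by k! distributes the multinomial coefficient over the factors, so induction on
  the index set only needs the binomial theorem, with \<open>j\<close> as the exponent of the new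
  element.\<close>

lemma fps_multinomial_exp_form:
  fixes x :: "'i \<Rightarrow> 'a::field_char_0 fps"
  assumes "finite A"
  shows "fps_const (1 / fact k) * (\<Sum>i\<in>A. x i) ^ k =
    (\<Sum>\<kappa> | \<kappa> \<in> A \<rightarrow>\<^sub>E UNIV \<and> sum \<kappa> A = k. \<Prod>i\<in>A. fps_const (1 / fact (\<kappa> i)) * x i ^ \<kappa> i)"
  using assms
proof (induction A arbitrary: k rule: finite_induct)
  case empty
  show ?case by (cases "k = 0") auto
next
  case (insert a A)
  let ?S = "\<lambda>B k. {\<kappa>::'i \<Rightarrow> nat. \<kappa> \<in> B \<rightarrow>\<^sub>E UNIV \<and> sum \<kappa> B = k}"
  let ?T = "\<lambda>B \<kappa>. \<Prod>i\<in>B. fps_const (1 / fact (\<kappa> i)) * x i ^ \<kappa> i"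
  let ?t = "\<lambda>j. fps_const (1 / fact j) * x a ^ j"
  have fin: "finite (?S B k)" if "finite B" for B k
  proof (rule finite_subset)
    show "?S B k \<subseteq> B \<rightarrow>\<^sub>E {..k}"
      using that by (auto simp: PiE_iff extensional_def intro!: member_le_sum)
  qed (use that in \<open>auto intro: finite_PiE\<close>)
  have "fps_const (1 / fact k) * (\<Sum>i\<in>insert a A. x i) ^ k =
      (\<Sum>j\<le>k. ?t j * (fps_const (1 / fact (k - j)) * (\<Sum>i\<in>A. x i) ^ (k - j)))"
    unfolding sum.insert[OF insert.hyps] binomial_ring sum_distrib_left
  proof (intro sum.cong refl)
    fix j assume "j \<in> {..k}"
    then have *: "fps_const (1 / fact k) * of_nat (k choose j) =
        fps_const (1 / fact j) * fps_const (1 / fact (k - j) :: 'a)"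
      by (simp add: binomial_fact flip: fps_of_nat)
    have "fps_const (1 / fact k) * (of_nat (k choose j) * x a ^ j * (\<Sum>i\<in>A. x i) ^ (k - j)) =
      (fps_const (1 / fact k) * of_nat (k choose j)) * (x a ^ j * (\<Sum>i\<in>A. x i) ^ (k - j))"
      by (simp only: mult_ac)
    then show "fps_const (1 / fact k) * (of_nat (k choose j) * x a ^ j * (\<Sum>i\<in>A. x i) ^ (k - j)) =
         ?t j * (fps_const (1 / fact (k - j)) * (\<Sum>i\<in>A. x i) ^ (k - j))"
      unfolding * by (simp only: mult_ac)
  qed
  also have "\<dots> = (\<Sum>j\<le>k. \<Sum>\<kappa>\<in>?S A (k - j). ?t j * ?T A \<kappa>)"
    by (simp add: insert.IH sum_distrib_left)
  also have "\<dots> = (\<Sum>(j, \<kappa>)\<in>Sigma {..k} (\<lambda>j. ?S A (k - j)). ?t j * ?T A \<kappa>)"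
    by (rule sum.Sigma) (auto intro: fin insert.hyps)
  also have "\<dots> = (\<Sum>\<kappa>\<in>?S (insert a A) k. ?T (insert a A) \<kappa>)"
  \<comment> \<open>A family on \<open>insert a A\<close> corresponds to its value at
    \<open>a\<close> and its restriction to \<open>A\<close>, which is extensional and hence
    \<open>undefined\<close> at \<open>a\<close>.\<close>
  proof (rule sum.reindex_bij_witness
      [of _ "\<lambda>\<kappa>. (\<kappa> a, \<kappa>(a := undefined))" "\<lambda>(j, \<kappa>). \<kappa>(a := j)"], goal_cases)
    case (1 s)
    then show ?case using insert.hyps by (auto simp: PiE_iff extensional_def fun_eq_iff)
  next
    case (2 s)
    obtain j \<kappa> where s: "s = (j, \<kappa>)" by force
    have "sum (\<kappa>(a := j)) A = sum \<kappa> A"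
      using insert.hyps by (intro sum.cong) auto
    then show ?case using 2 s insert.hyps by (auto simp: PiE_iff extensional_def)
  next
    case (3 \<kappa>)
    then show ?case by auto
  next
    case (4 \<kappa>)
    have "sum (\<kappa>(a := undefined)) A = sum \<kappa> A"
      using insert.hyps by (intro sum.cong) auto
    then show ?case using 4 insert.hyps by (auto simp: PiE_iff extensional_def)
  next
    case (5 s)
    obtain j \<kappa> where s: "s = (j, \<kappa>)" by force
    have "?T A (\<kappa>(a := j)) = ?T A \<kappa>"
      using insert.hyps by (intro prod.cong) auto
    then show ?case using s insert.hyps by simp
  qed
  finally show ?case .
qed

lemma fps_const_prod: "fps_const (\<Prod>i\<in>A. f i) = (\<Prod>i\<in>A. fps_const (f i :: 'a::comm_ring_1))"
  by (induction A rule: infinite_finite_induct) (simp_all flip: fps_const_mult)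

text \<open>This is the binomial series of exponent -n composed with u; its k-th coefficient is
  (-1)^k [n]_k / k!. The sum stops at \<open>a\<close> because u^k has no terms below degree
  k.\<close>

lemma fps_one_plus_inverse_power_nth:
  fixes u :: "'a::field_char_0 fps"
  assumes "u $ 0 = 0"
  shows "(inverse (1 + u) ^ n) $ a = 
    (\<Sum>k=0..a. (-1) ^ k * pochhammer (of_nat n) k * ((u ^ k) $ a / fact k))"
proof -
  have "inverse (1 + u) ^ n = fps_binomial (- of_nat n) oo u"
    using assms by (simp add: fps_binomial_minus_of_nat fps_inverse_compose fps_compose_add_distrib
        fps_compose_power[symmetric] fps_inverse_power)
  then show ?thesis
    by (simp add: fps_compose_nth gbinomial_pochhammer)
qed

section \<open>Inverses of real polynomials\<close>

text \<open>Carries the formal inverse, computed over the reals, to the complex numbers, where it is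
  compared with the expansion of a holomorphic function.\<close>

definition fps_of_real :: "real fps \<Rightarrow> 'a::real_field fps" where
  "fps_of_real f = Abs_fps (\<lambda>n. of_real (f $ n))"

lemma fps_of_real_nth [simp]: "fps_of_real f $ n = of_real (f $ n)"
  by (simp add: fps_of_real_def)

lemma fps_of_real_mult: "fps_of_real (f * g) = fps_of_real f * fps_of_real g"
  by (simp add: fps_eq_iff fps_mult_nth)

lemma fps_of_real_power: "fps_of_real (f ^ n) = fps_of_real f ^ n"
  by (induction n) (simp_all add: fps_of_real_mult, simp add: fps_eq_iff)

lemma fps_of_real_compose: "fps_of_real (f oo g) = fps_of_real f oo fps_of_real g"
  by (simp add: fps_eq_iff fps_compose_nth flip: fps_of_real_power)

lemma fps_of_poly_of_real: "fps_of_poly (map_poly of_real p) = fps_of_real (fps_of_poly p)"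
  by (simp add: fps_eq_iff coeff_map_poly)

lemma poly_map_poly_of_real:
  "poly (map_poly of_real p) (of_real x) = of_real (poly p x)"
  by (induction p) (simp_all add: map_poly_pCons)

lemma pderiv_map_poly_of_real:
  "pderiv (map_poly of_real p :: 'a::real_field poly) = map_poly of_real (pderiv p)"
  by (intro poly_eqI) (simp add: coeff_pderiv coeff_map_poly)

lemma poly_has_fps_expansion:
  fixes p :: "'a::{banach, real_normed_field} poly"
  shows "poly p has_fps_expansion fps_of_poly p"
proof -
  have "eval_fps (fps_of_poly p) has_fps_expansion fps_of_poly p"
    by (intro eval_fps_has_fps_expansion) simp
  moreover have "eval_fps (fps_of_poly p) = poly p"
    by (simp add: fun_eq_iff)
  ultimately show ?thesis
    by simp
qed

section \<open>Positive derivatives, injectivity and the holomorphic inverse\<close>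

lemma poly_less_if_pderiv_pos:
  fixes p :: "real poly"
  assumes "x < y" and pos: "\<And>z. z \<in> {x..y} \<Longrightarrow> poly (pderiv p) z > 0"
  shows "poly p x < poly p y"
  using \<open>x < y\<close>
proof (rule DERIV_pos_imp_increasing)
  fix z assume "x \<le> z" "z \<le> y"
  then show "\<exists>d. (poly p has_real_derivative d) (at z) \<and> d > 0"
    using pos poly_DERIV by (intro exI[of _ "poly (pderiv p) z"]) auto
qed

text \<open>Noshiro-Warschawski theorem: a common value at two distinct points would, by a mean
  value theorem, force Re f' to vanish somewhere on the segment between them.\<close>

lemma inj_on_convex_Re_deriv_pos:
  assumes "convex S"
    and deriv: "\<And>z. z \<in> S \<Longrightarrow> (f has_field_derivative f' z) (at z)"
    and pos: "\<And>z. z \<in> S \<Longrightarrow> Re (f' z) > 0"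
  shows "inj_on f S"
proof (rule inj_onI, rule ccontr)
  fix w z assume wz: "w \<in> S" "z \<in> S" "f w = f z" "w \<noteq> z"
  have seg: "closed_segment w z \<subseteq> S"
    using wz \<open>convex S\<close> by (simp add: closed_segment_subset)
  \<comment> \<open>The complex mean value theorem controls only the real part of an increment;
    division by \<open>z - w\<close> cancels the direction of the segment, so that
    \<open>Re (f' u)\<close> itself appears.\<close>
  have "((\<lambda>v. f v / (z - w)) has_field_derivative f' u / (z - w)) (at u)"
    if "u \<in> closed_segment w z" for u
    using deriv[of u] seg that by (auto intro: DERIV_cdivide)
  from complex_mvt_line[of w z, OF this] obtain u where "u \<in> closed_segment w z"
      "Re (f z / (z - w)) - Re (f w / (z - w)) = Re (f' u / (z - w) * (z - w))"
    by blast
  then show False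
    using pos[of u] seg wz by auto
qed

text \<open>On a convex neighbourhood of [0,1] where the derivative has positive real part the
  polynomial is injective, hence has a holomorphic inverse on the image. The expansion of this
  inverse at 0 is the formal inverse, because composing it with the polynomial gives the
  identity.\<close>

lemma poly_inverse_analytic:
  fixes p :: "real poly"
  assumes p0: "poly p 0 = 0" and pos: "\<And>x. x \<in> {0..1} \<Longrightarrow> poly (pderiv p) x > 0"
  obtains g :: "complex \<Rightarrow> complex" where
    "g analytic_on of_real ` poly p ` {0..1}"
    "g has_fps_expansion fps_of_real (fps_inv (fps_of_poly p))"
    "\<And>x. x \<in> {0..1} \<Longrightarrow> g (of_real (poly p x)) = of_real x"
proof -
  define P :: "complex poly" where "P = map_poly of_real p"
  define I :: "complex set" where "I = of_real ` {0..1}"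
  define U where "U = {z. 0 < Re (poly (pderiv P) z)}"
  have "open U"
    unfolding U_def by (intro open_Collect_less continuous_intros)
  have I: "compact I" "convex I"
    unfolding I_def
    by (auto intro!: compact_continuous_image continuous_intros convex_linear_image linearI simp: scaleR_conv_of_real)
  have "I \<subseteq> U"
    using pos by (auto simp: I_def U_def P_def pderiv_map_poly_of_real poly_map_poly_of_real)
  then obtain e where e: "e > 0" "(\<Union>x\<in>I. ball x e) \<subseteq> U"
    using compact_subset_open_imp_ball_epsilon_subset[OF I(1) \<open>open U\<close>] by blast
  define V where "V = (\<Union>x\<in>I. ball x e)"
  \<comment> \<open>As the Minkowski sum of the convex set \<open>I\<close> and a ball,
    \<open>V\<close> is convex.\<close>
  have V_eq: "V = (\<Union>x\<in>I. \<Union>y\<in>ball 0 e. {x + y})"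
    unfolding V_def
  proof (intro SUP_cong refl)
    fix x :: complex
    show "ball x e = (\<Union>y\<in>ball 0 e. {x + y})"
      by (auto simp: dist_norm norm_minus_commute intro!: bexI[of _ "_ - x"])
  qed
  have V: "open V" "convex V" "V \<subseteq> U" "I \<subseteq> V"
    using e convex_sums[OF I(2) convex_ball, of 0 e] unfolding V_eq[symmetric]
    by (auto simp: V_def)
  have "inj_on (poly P) V"
    using V by (intro inj_on_convex_Re_deriv_pos[OF _ poly_DERIV]) (auto simp: U_def)
  moreover have "poly P holomorphic_on V"
    by (intro holomorphic_intros)
  ultimately obtain g where g: "g holomorphic_on poly P ` V" "\<And>z. z \<in> V \<Longrightarrow> g (poly P z) = z"
    using holomorphic_has_inverse[OF _ V(1)] by metis
  have op: "open (poly P ` V)"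
    using V \<open>inj_on (poly P) V\<close> \<open>poly P holomorphic_on V\<close> by (intro open_mapping_thm3)
  have ana: "g analytic_on poly P ` V"
    using g(1) op by (simp add: analytic_on_open)
  have "g (of_real (poly p x)) = of_real x" if "x \<in> {0..1}" for x
    using g(2)[of "of_real x"] that V(4) by (force simp: P_def poly_map_poly_of_real I_def)
  moreover have "of_real ` poly p ` {0..1} = poly P ` I"
    unfolding I_def image_image P_def poly_map_poly_of_real ..
  then have "g analytic_on of_real ` poly p ` {0..1}"
    using ana V(4) by (metis analytic_on_subset image_mono)
  moreover have "g has_fps_expansion fps_of_real (fps_inv (fps_of_poly p))"
  proof -
    let ?F = "fps_of_poly p" and ?G = "fps_of_poly P"
    have "0 \<in> V"
      using V(4) by (auto simp: I_def)
    have P0: "poly P 0 = 0"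
      using p0 by (simp add: P_def poly_0_coeff_0 coeff_map_poly)
    have "0 \<in> poly P ` V"
      using \<open>0 \<in> V\<close> P0 by force
    then obtain E where E: "g has_fps_expansion E"
      using ana analytic_on_subset[of g _ "{0}"] analytic_at_imp_has_fps_expansion_0 by blast
    have F: "?F $ 0 = 0" "?F $ 1 \<noteq> 0"
      using p0 pos[of 0] by (simp_all add: poly_0_coeff_0 coeff_pderiv)
    have "(g \<circ> poly P) has_fps_expansion (E oo ?G)"
      by (intro has_fps_expansion_compose E poly_has_fps_expansion)
         (use P0 in \<open>simp add: poly_0_coeff_0\<close>)
    moreover have "(g \<circ> poly P) has_fps_expansion fps_X"
    proof -
      have "eventually (\<lambda>z. (g \<circ> poly P) z = z) (nhds 0)"
        using g(2) V(1) \<open>0 \<in> V\<close> by (auto simp: eventually_nhds)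
      then show ?thesis
        using has_fps_expansion_fps_X has_fps_expansion_cong by fast
    qed
    ultimately have EG: "E oo ?G = fps_X"
      by (rule fps_expansion_unique_complex)
    \<comment> \<open>A left inverse \<open>E\<close> and a right inverse of \<open>?G\<close> under
      composition coincide by associativity.\<close>
    have "?G oo fps_of_real (fps_inv ?F) = fps_of_real (?F oo fps_inv ?F)"
      by (simp add: P_def fps_of_poly_of_real fps_of_real_compose)
    also have "\<dots> = fps_X"
      by (simp add: fps_inv_right[OF F]) (simp add: fps_eq_iff fps_X_def)
    finally have "E oo (?G oo fps_of_real (fps_inv ?F)) = E"
      by simp
    moreover have "E oo (?G oo fps_of_real (fps_inv ?F)) = fps_of_real (fps_inv ?F)"
      using F P0 by (subst fps_compose_assoc) (simp_all add: EG fps_inv_def poly_0_coeff_0)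
    ultimately show ?thesis
      using E by simp
  qed
  ultimately show ?thesis
    using that by blast
qed

text \<open>If g is the holomorphic inverse, the rescaled coefficients belong to the function
  sending z to g(c z), so the point p(y) is divided by c. In the application \<open>c\<close> is
  \<open>pmf p 1\<close>.\<close>

lemma continued_sum_inverse_poly:
  fixes p :: "real poly"
  assumes p0: "poly p 0 = 0" and pos: "\<And>x. x \<in> {0..1} \<Longrightarrow> poly (pderiv p) x > 0"
    and y: "y \<in> {0..1}" and c: "c > 0"
  shows "continued_sum (\<lambda>n. c ^ n * fps_inv (fps_of_poly p) $ n) (poly p y / c) y"
proof -
  define G where "G = fps_inv (fps_of_poly p)"
  obtain g :: "complex \<Rightarrow> complex" where g:
    "g analytic_on of_real ` poly p ` {0..1}"
    "g has_fps_expansion fps_of_real G"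
    "\<And>x. x \<in> {0..1} \<Longrightarrow> g (of_real (poly p x)) = of_real x"
    unfolding G_def using poly_inverse_analytic[OF p0 pos] by blast
  define C where "C = complex_of_real c"
  have lin: "((*) C) has_fps_expansion (fps_const C * fps_X)"
    by (intro fps_expansion_intros)
  have "(g \<circ> (*) C) has_fps_expansion (fps_of_real G oo (fps_const C * fps_X))"
    by (rule has_fps_expansion_compose[OF g(2) lin]) simp
  also have "fps_of_real G oo (fps_const C * fps_X) = Abs_fps (\<lambda>n. of_real (c ^ n * G $ n))"
    by (simp add: fps_compose_linear fps_eq_iff C_def)
  finally have 1: "(g \<circ> (*) C) has_fps_expansion Abs_fps (\<lambda>n. of_real (c ^ n * G $ n))" .
  \<comment> \<open>By the intermediate value theorem the whole path of continuation lies in the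
    image of [0,1], where \<open>g\<close> is analytic.\<close>
  have seg: "closed_segment 0 (poly p y) \<subseteq> poly p ` {0..1}"
  proof
    fix t assume "t \<in> closed_segment 0 (poly p y)"
    moreover have "0 \<le> poly p y"
      using poly_less_if_pderiv_pos[of 0 y p] y pos p0 by (cases "y = 0") auto
    ultimately have "poly p 0 \<le> t" "t \<le> poly p y"
      using p0 by (auto simp: closed_segment_eq_real_ivl)
    then show "t \<in> poly p ` {0..1}"
      using IVT'[of "poly p" 0 t y] y by (force intro: continuous_intros)
  qed
  have "(*) C ` of_real ` closed_segment 0 (poly p y / c) \<subseteq> of_real ` poly p ` {0..1}"
  proof -
    have "c * s \<in> closed_segment 0 (poly p y)" if "s \<in> closed_segment 0 (poly p y / c)" for s
      using that c by (auto simp: in_segment)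
    then show ?thesis
      using seg by (force simp: C_def simp flip: of_real_mult)
  qed
  then have 2: "(g \<circ> (*) C) analytic_on of_real ` closed_segment 0 (poly p y / c)"
    by (intro analytic_on_compose analytic_on_subset[OF g(1)] analytic_intros)
  have 3: "(g \<circ> (*) C) (of_real (poly p y / c)) = of_real y"
    using g(3)[OF y] c by (simp add: C_def)
  from 1 2 3 show ?thesis
    unfolding continued_sum_def G_def by blast
qed

section \<open>Abel's limit theorem and the sum at the endpoint\<close>

lemma Abel_limit:
  fixes a :: "nat \<Rightarrow> real"
  assumes a: "summable a"
  shows "((\<lambda>x. \<Sum>n. a n * x ^ n) \<longlongrightarrow> suminf a) (at_left 1)"
proof -
  define r where "r n = (\<Sum>k\<le>n. a k) - suminf a" for n
  have r: "r \<longlonglongrightarrow> 0"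
    unfolding r_def using summable_LIMSEQ'[OF a] by (simp add: LIM_zero_iff)
  obtain K where K: "\<And>n. \<bar>r n\<bar> \<le> K"
    using convergent_imp_Bseq[OF convergentI[OF r]] by (auto simp: Bseq_def)
  have summable_r: "summable (\<lambda>n. \<bar>r n\<bar> * x ^ n)" if "0 \<le> x" "x < 1" for x
  proof (rule summable_comparison_test)
    show "summable (\<lambda>n. K * x ^ n)"
      using that by (intro summable_mult summable_geometric) auto
    show "\<exists>N. \<forall>n\<ge>N. norm (\<bar>r n\<bar> * x ^ n) \<le> K * x ^ n"
      using K that by (auto simp: abs_mult intro!: mult_right_mono)
  qed
  \<comment> \<open>Summation by parts with the errors \<open>r\<close> of the partial sums. As
    \<open>r\<close> tends to 0, the factor \<open>1 - x\<close> outweighs the growth of the series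
    on the right.\<close>
  have by_parts: "(\<Sum>n. a n * x ^ n) - suminf a = (1 - x) * (\<Sum>n. r n * x ^ n)"
    if x: "0 \<le> x" "x < 1" for x
  proof -
    have sr: "summable (\<lambda>n. r n * x ^ n)"
      by (rule summable_rabs_cancel) (use summable_r[OF x] x in \<open>simp add: abs_mult\<close>)
    define R where "R = (\<Sum>n. r n * x ^ n)"
    have R: "(\<lambda>n. r n * x ^ n) sums R"
      unfolding R_def using sr by (rule summable_sums)
    have "(\<lambda>n. r (Suc n) * x ^ Suc n - r n * x ^ n * x) sums ((R - r 0 * x ^ 0) - R * x)"
    proof (intro sums_diff sums_mult2 R)
      show "(\<lambda>n. r (Suc n) * x ^ Suc n) sums (R - r 0 * x ^ 0)"
        using R sums_Suc_iff[of "\<lambda>n. r n * x ^ n" "R - r 0 * x ^ 0"] by simp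
    qed
    moreover have "r (Suc n) * x ^ Suc n - r n * x ^ n * x = a (Suc n) * x ^ Suc n" for n
      by (simp add: r_def algebra_simps)
    ultimately have "(\<lambda>n. a (Suc n) * x ^ Suc n) sums ((R - r 0) - R * x)"
      by simp
    then have "(\<lambda>n. a n * x ^ n) sums ((R - r 0) - R * x + a 0 * x ^ 0)"
      by (rule sums_Suc)
    then have "(\<Sum>n. a n * x ^ n) = (R - r 0) - R * x + a 0 * x ^ 0"
      by (rule sums_unique[symmetric])
    moreover have "a 0 = r 0 + suminf a"
      by (simp add: r_def)
    ultimately show ?thesis
      unfolding R_def[symmetric] by (simp add: algebra_simps)
  qed
  show ?thesis
  proof (rule tendstoI)
    fix e :: real assume e: "e > 0"
    obtain M where M: "\<And>n. n \<ge> M \<Longrightarrow> \<bar>r n\<bar> < e / 2"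
      using LIMSEQ_D[OF r, of "e / 2"] e by auto
    \<comment> \<open>The first \<open>M\<close> terms contribute at most \<open>B\<close>, which
      the factor \<open>1 - x\<close> makes small; the others are bounded by \<open>e / 2\<close>
      times a geometric series of sum \<open>1 / (1 - x)\<close>, which the same factor
      cancels.\<close>
    define B where "B = (\<Sum>n<M. \<bar>r n\<bar>)"
    have "((\<lambda>x. (1 - x) * B) \<longlongrightarrow> (1 - 1) * B) (at_left 1)"
      by (intro tendsto_intros)
    then have "\<forall>\<^sub>F x in at_left 1. (1 - x) * B < e / 2"
      using e by (intro order_tendstoD) auto
    moreover have "\<forall>\<^sub>F x in at_left (1::real). 0 < x"
      by (rule eventually_at_leftI[of 0]) auto
    moreover have "\<forall>\<^sub>F x in at_left (1::real). x < 1"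
      by (rule eventually_at_leftI[of 0]) auto
    ultimately show "\<forall>\<^sub>F x in at_left 1. dist (\<Sum>n. a n * x ^ n) (suminf a) < e"
    proof eventually_elim
      case (elim x)
      have major: "(\<lambda>n. (if n < M then \<bar>r n\<bar> else 0) + e / 2 * x ^ n) sums (B + e / 2 * (1 / (1 - x)))"
      proof (intro sums_add sums_mult)
        show "(\<lambda>n. if n < M then \<bar>r n\<bar> else 0) sums B"
          using sums_If_finite_set[of "{..<M}" "\<lambda>n. \<bar>r n\<bar>"] by (simp add: B_def)
        show "(\<lambda>n. x ^ n) sums (1 / (1 - x))"
          using elim by (intro geometric_sums) simp
      qed
      have minor: "\<bar>r n\<bar> * x ^ n \<le> (if n < M then \<bar>r n\<bar> else 0) + e / 2 * x ^ n" for n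
      proof (cases "n < M")
        case True
        have "\<bar>r n\<bar> * x ^ n \<le> \<bar>r n\<bar> * 1"
          using elim by (intro mult_left_mono power_le_one) auto
        moreover have "0 \<le> e / 2 * x ^ n"
          using e elim by simp
        ultimately show ?thesis
          using True by simp
      next
        case False
        then show ?thesis
          using M[of n] elim by (auto intro!: mult_right_mono)
      qed
      have sr: "summable (\<lambda>n. \<bar>r n\<bar> * x ^ n)"
        using elim by (intro summable_r) auto
      have le: "(\<Sum>n. \<bar>r n\<bar> * x ^ n) \<le> B + e / 2 * (1 / (1 - x))"
        using minor summable_sums[OF sr] major by (rule sums_le)
      have "\<bar>\<Sum>n. r n * x ^ n\<bar> \<le> (\<Sum>n. \<bar>r n\<bar> * x ^ n)"
        using summable_rabs[of "\<lambda>n. r n * x ^ n"] sr elim by (simp add: abs_mult)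
      with le have "(1 - x) * \<bar>\<Sum>n. r n * x ^ n\<bar> \<le> (1 - x) * (B + e / 2 * (1 / (1 - x)))"
        using elim by (intro mult_left_mono) auto
      also have "\<dots> = (1 - x) * B + e / 2"
        using elim by (simp add: field_simps)
      also have "\<dots> < e"
        using elim by simp
      finally show ?case
        using by_parts[of x] elim by (simp add: dist_real_def abs_mult)
    qed
  qed
qed

text \<open>For 0 < t < y the point p(t)/c lies strictly inside the disc of convergence, so the
  ordinary sum there equals the continued value t. When t tends to y, Abel's theorem identifies the
  sum at the endpoint.\<close>

lemma sums_inverse_poly:
  fixes p :: "real poly"
  assumes p0: "poly p 0 = 0" and pos: "\<And>x. x \<in> {0..1} \<Longrightarrow> poly (pderiv p) x > 0"
    and y: "y \<in> {0..1}" and c: "c > 0"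
    and h_def: "h = (\<lambda>n. c ^ n * fps_inv (fps_of_poly p) $ n)"
    and summ: "summable (\<lambda>n. h n * (poly p y / c) ^ n)"
  shows "(\<lambda>n. h n * (poly p y / c) ^ n) sums y"
proof (cases "y = 0")
  case True
  then show ?thesis
    using powser_sums_zero[of h] p0 by (simp add: h_def fps_inv_def)
next
  case False
  define x where "x = poly p y / c"
  define f where "f u = (\<Sum>n. h n * x ^ n * u ^ n)" for u
  \<comment> \<open>\<open>u t\<close> is the position of \<open>poly p t / c\<close> relative to
    the endpoint \<open>x\<close>. It approaches 1 from below when \<open>t\<close> approaches
    \<open>y\<close> from below, which is the one-sided limit in Abel's theorem.\<close>
  define u where "u t = poly p t / poly p y" for t
  have mono: "poly p s < poly p t" if "0 \<le> s" "s < t" "t \<le> y" for s t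
    using that y by (intro poly_less_if_pderiv_pos pos) auto
  have py: "0 < poly p y"
    using mono[of 0 y] False y p0 by simp
  have "ereal (norm x) \<le> conv_radius h"
    using summ by (intro conv_radius_geI) (simp add: x_def)
  have near: "\<forall>\<^sub>F t in at_left y. t \<in> {0<..<y}"
    using False y by (intro eventually_at_leftI[of 0]) auto
  have fu: "f (u t) = t" if t: "t \<in> {0<..<y}" for t
  proof -
    have "0 < poly p t" "poly p t < poly p y"
      using mono[of 0 t] mono[of t y] t p0 by auto
    then have "ereal \<bar>poly p t / c\<bar> < ereal (norm x)"
      using c py by (simp add: x_def divide_strict_right_mono)
    also have "\<dots> \<le> conv_radius h" by fact
    finally have "continued_sum h (poly p t / c) (\<Sum>n. h n * (poly p t / c) ^ n)"
      by (rule continued_sum_in_disc)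
    moreover have "continued_sum h (poly p t / c) t"
      unfolding h_def using t y by (intro continued_sum_inverse_poly p0 pos c) auto
    ultimately have "(\<Sum>n. h n * (poly p t / c) ^ n) = t"
      by (rule continued_sum_unique)
    moreover have "poly p t / c = x * u t"
      using py by (simp add: x_def u_def)
    ultimately show ?thesis
      by (simp add: f_def power_mult_distrib mult.assoc)
  qed
  have "\<forall>\<^sub>F t in at_left y. f (u t) = t"
    using near fu by (rule eventually_mono)
  moreover have "((\<lambda>t. t) \<longlongrightarrow> y) (at_left y)"
    by (rule tendsto_ident_at)
  ultimately have "((\<lambda>t. f (u t)) \<longlongrightarrow> y) (at_left y)"
    by (simp cong: tendsto_cong)
  moreover have "((\<lambda>t. f (u t)) \<longlongrightarrow> (\<Sum>n. h n * x ^ n)) (at_left y)"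
  proof (rule filterlim_compose[of f _ "at_left 1" u])
    show "(f \<longlongrightarrow> (\<Sum>n. h n * x ^ n)) (at_left 1)"
      unfolding f_def using summ by (intro Abel_limit) (simp add: x_def)
    have "(u \<longlongrightarrow> u y) (at_left y)"
      unfolding u_def by (intro tendsto_intros) (use py in auto)
    then have "(u \<longlongrightarrow> 1) (at_left y)"
      using py by (simp add: u_def)
    moreover have "\<forall>\<^sub>F t in at_left y. u t \<in> {..<1} \<and> u t \<noteq> 1"
      using near 
    proof eventually_elim
      case (elim t)
      then have "poly p t < poly p y"
        using mono[of t y] by simp
      then show ?case
        using py by (simp add: u_def)
    qed
    ultimately show "filterlim u (at_left 1) (at_left y)"
      by (simp add: filterlim_at)
  qed
  ultimately have "(\<Sum>n. h n * x ^ n) = y"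
    using tendsto_unique trivial_limit_at_left_real by blast
  then show ?thesis
    using summ by (simp add: x_def sums_iff)
qed

section \<open>Positive stochastic matrices\<close>

lemma ex_pmf_finite_support:
  fixes f :: "'a \<Rightarrow> real"
  assumes fin: "finite A" and pos: "\<And>x. x \<in> A \<Longrightarrow> f x > 0" and sum: "sum f A = 1"
  shows "\<exists>p. set_pmf p = A \<and> (\<forall>x\<in>A. pmf p x = f x)"
proof -
  let ?g = "\<lambda>x. if x \<in> A then f x else 0"
  have nonneg: "\<And>x. 0 \<le> ?g x"
    using pos by (auto intro: less_imp_le)
  have "(\<integral>\<^sup>+x. ennreal (?g x) \<partial>count_space UNIV) = (\<Sum>x\<in>A. ennreal (?g x))"
    using fin by (intro nn_integral_count_space') auto
  also have "\<dots> = ennreal (\<Sum>x\<in>A. ?g x)"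
    using nonneg by (rule sum_ennreal)
  finally have int: "(\<integral>\<^sup>+x. ennreal (?g x) \<partial>count_space UNIV) = 1"
    using sum by simp
  have "set_pmf (embed_pmf ?g) = A"
    using pos by (force simp: set_embed_pmf[OF nonneg int])
  then show ?thesis
    by (intro exI[of _ "embed_pmf ?g"]) (simp add: pmf_embed_pmf[OF nonneg int])
qed

context
  fixes A :: "'a set" and P :: "'a \<Rightarrow> 'a \<Rightarrow> real"
  assumes fin: "finite A" and ne: "A \<noteq> {}"
    and pos: "\<And>i j. i \<in> A \<Longrightarrow> j \<in> A \<Longrightarrow> P i j > 0"
    and stoch: "\<And>i. i \<in> A \<Longrightarrow> (\<Sum>j\<in>A. P i j) = 1"
begin

lemma sum_stochastic: "(\<Sum>j\<in>A. \<Sum>i\<in>A. x i * P i j) = sum x A"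
proof -
  have "(\<Sum>j\<in>A. \<Sum>i\<in>A. x i * P i j) = (\<Sum>i\<in>A. x i * (\<Sum>j\<in>A. P i j))"
    unfolding sum_distrib_left by (rule sum.swap)
  then show ?thesis
    by (simp add: stoch)
qed

text \<open>Doeblin's argument: the least entry \<open>e\<close> can be subtracted from every transition probability
  without changing the image of a vector of total mass \<open>0\<close>.\<close>

lemma positive_stochastic_contraction:
  "\<exists>\<rho>. 0 \<le> \<rho> \<and> \<rho> < 1 \<and>
    (\<forall>x. sum x A = 0 \<longrightarrow> (\<Sum>j\<in>A. \<bar>\<Sum>i\<in>A. x i * P i j\<bar>) \<le> \<rho> * (\<Sum>i\<in>A. \<bar>x i\<bar>))"
proof -
  define e where "e = Min ((\<lambda>(i, j). P i j) ` (A \<times> A))"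
  have e_le: "e \<le> P i j" if "i \<in> A" "j \<in> A" for i j
    unfolding e_def using fin that by (intro Min_le) (auto intro!: image_eqI[of _ _ "(i, j)"])
  have "e \<in> (\<lambda>(i, j). P i j) ` (A \<times> A)"
    unfolding e_def using fin ne by (intro Min_in) auto
  then have e_pos: "e > 0"
    using pos by auto
  \<comment> \<open>Comparing one row with its sum 1 shows that the contraction factor is not
    negative.\<close>
  obtain a where a: "a \<in> A"
    using ne by blast
  have "card A * e \<le> (\<Sum>j\<in>A. P a j)"
    using e_le a by (intro sum_bounded_below) auto
  then have "0 \<le> 1 - card A * e"
    using stoch[OF a] by simp
  moreover have "1 - card A * e < 1"
    using e_pos fin ne by (simp add: card_gt_0_iff)
  moreover have "(\<Sum>j\<in>A. \<bar>\<Sum>i\<in>A. x i * P i j\<bar>) \<le> (1 - card A * e) * (\<Sum>i\<in>A. \<bar>x i\<bar>)"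
    if x: "sum x A = 0" for x
  proof -
    have "(\<Sum>j\<in>A. \<bar>\<Sum>i\<in>A. x i * P i j\<bar>) \<le> (\<Sum>j\<in>A. \<Sum>i\<in>A. \<bar>x i\<bar> * (P i j - e))"
    proof (rule sum_mono)
      fix j assume j: "j \<in> A"
      have "(\<Sum>i\<in>A. x i * P i j) = (\<Sum>i\<in>A. x i * (P i j - e))"
        using x by (simp add: right_diff_distrib sum_subtractf flip: sum_distrib_right)
      also have "\<bar>\<dots>\<bar> \<le> (\<Sum>i\<in>A. \<bar>x i * (P i j - e)\<bar>)"
        by (rule sum_abs)
      also have "\<dots> = (\<Sum>i\<in>A. \<bar>x i\<bar> * (P i j - e))"
        using e_le j by (intro sum.cong refl) (simp add: abs_mult)
      finally show "\<bar>\<Sum>i\<in>A. x i * P i j\<bar> \<le> (\<Sum>i\<in>A. \<bar>x i\<bar> * (P i j - e))" .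
    qed
    also have "\<dots> = (\<Sum>i\<in>A. \<bar>x i\<bar> * (\<Sum>j\<in>A. P i j - e))"
      unfolding sum_distrib_left by (rule sum.swap)
    also have "\<dots> = (1 - card A * e) * (\<Sum>i\<in>A. \<bar>x i\<bar>)"
      by (simp add: sum_subtractf stoch sum_distrib_right mult.commute)
    finally show ?thesis .
  qed
  ultimately show ?thesis
    by blast
qed

text \<open>The difference of two fixed vectors of equal total has total 0 and is fixed as well. By
  contraction its l^1 norm is at most \<rho> < 1 times itself, hence 0.\<close>

lemma stationary_distribution_unique:
  assumes "\<And>j. j \<in> A \<Longrightarrow> (\<Sum>i\<in>A. x i * P i j) = x j"
    and "\<And>j. j \<in> A \<Longrightarrow> (\<Sum>i\<in>A. y i * P i j) = y j"
    and "sum x A = sum y A" and "j \<in> A"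
  shows "x j = y j"
proof -
  obtain \<rho> where \<rho>: "\<rho> < 1"
    "\<And>x. sum x A = 0 \<Longrightarrow> (\<Sum>j\<in>A. \<bar>\<Sum>i\<in>A. x i * P i j\<bar>) \<le> \<rho> * (\<Sum>i\<in>A. \<bar>x i\<bar>)"
    using positive_stochastic_contraction by blast
  let ?d = "\<lambda>i. x i - y i" and ?s = "\<Sum>i\<in>A. \<bar>x i - y i\<bar>"
  have "(\<Sum>i\<in>A. ?d i * P i j) = ?d j" if "j \<in> A" for j
    using that assms by (simp add: left_diff_distrib sum_subtractf)
  then have "?s = (\<Sum>j\<in>A. \<bar>\<Sum>i\<in>A. ?d i * P i j\<bar>)"
    by simp
  also have "\<dots> \<le> \<rho> * ?s"
    using assms by (intro \<rho>) (simp add: sum_subtractf)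
  finally have "(1 - \<rho>) * ?s \<le> 0"
    by (simp add: algebra_simps)
  then have "?s \<le> 0"
    using \<rho>(1) by (simp add: mult_le_0_iff)
  then have "?s = 0"
    by (intro antisym sum_nonneg) auto
  then show ?thesis
    using fin \<open>j \<in> A\<close> by (simp add: sum_nonneg_eq_0_iff)
qed

text \<open>The iterates of the uniform law converge because their increments have total 0 and
  shrink geometrically; the limit is a fixed vector of total 1.\<close>

lemma stationary_distribution_exists:
  "\<exists>x. (\<forall>j\<in>A. x j > 0) \<and> sum x A = 1 \<and> (\<forall>j\<in>A. (\<Sum>i\<in>A. x i * P i j) = x j)"
proof -
  obtain \<rho> where \<rho>: "0 \<le> \<rho>" "\<rho> < 1"
    "\<And>x. sum x A = 0 \<Longrightarrow> (\<Sum>j\<in>A. \<bar>\<Sum>i\<in>A. x i * P i j\<bar>) \<le> \<rho> * (\<Sum>i\<in>A. \<bar>x i\<bar>)"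
    using positive_stochastic_contraction by blast
  define \<mu> where "\<mu> = rec_nat (\<lambda>_. 1 / card A) (\<lambda>_ m j. \<Sum>i\<in>A. m i * P i j)"
  have \<mu>0: "\<mu> 0 = (\<lambda>_. 1 / card A)" and \<mu>Suc: "\<mu> (Suc n) j = (\<Sum>i\<in>A. \<mu> n i * P i j)" for n j
    by (simp_all add: \<mu>_def)
  have sum1: "sum (\<mu> n) A = 1" for n
    by (induction n) (use fin ne in \<open>simp_all add: \<mu>0 \<mu>Suc sum_stochastic\<close>)
  have nonneg: "0 \<le> \<mu> n j" if "j \<in> A" for n j
    using that
    by (induction n arbitrary: j)
      (auto simp: \<mu>0 \<mu>Suc intro!: sum_nonneg mult_nonneg_nonneg less_imp_le[OF pos])
  define \<delta> where "\<delta> n i = \<mu> (Suc n) i - \<mu> n i" for n i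
  have \<delta>Suc: "\<delta> (Suc n) j = (\<Sum>i\<in>A. \<delta> n i * P i j)" for n j
    by (simp add: \<delta>_def \<mu>Suc left_diff_distrib sum_subtractf)
  have bound: "(\<Sum>i\<in>A. \<bar>\<delta> n i\<bar>) \<le> \<rho> ^ n * (\<Sum>i\<in>A. \<bar>\<delta> 0 i\<bar>)" for n
  proof (induction n)
    case (Suc n)
    have "sum (\<delta> n) A = 0"
      unfolding \<delta>_def sum_subtractf sum1 by simp
    then have "(\<Sum>i\<in>A. \<bar>\<delta> (Suc n) i\<bar>) \<le> \<rho> * (\<Sum>i\<in>A. \<bar>\<delta> n i\<bar>)"
      unfolding \<delta>Suc by (rule \<rho>(3))
    also have "\<dots> \<le> \<rho> * (\<rho> ^ n * (\<Sum>i\<in>A. \<bar>\<delta> 0 i\<bar>))"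
      using Suc \<rho>(1) by (rule mult_left_mono)
    finally show ?case by (simp add: mult.assoc)
  qed simp
  have "convergent (\<lambda>n. \<mu> n j)" if "j \<in> A" for j
  proof -
    have "summable (\<lambda>n. \<delta> n j)"
    proof (rule summable_comparison_test)
      show "summable (\<lambda>n. \<rho> ^ n * (\<Sum>i\<in>A. \<bar>\<delta> 0 i\<bar>))"
        using \<rho> by (intro summable_mult2 summable_geometric) auto
      have "\<bar>\<delta> n j\<bar> \<le> (\<Sum>i\<in>A. \<bar>\<delta> n i\<bar>)" for n
        using fin that by (intro member_le_sum[of j A "\<lambda>i. \<bar>\<delta> n i\<bar>"]) auto
      then show "\<exists>N. \<forall>n\<ge>N. norm (\<delta> n j) \<le> \<rho> ^ n * (\<Sum>i\<in>A. \<bar>\<delta> 0 i\<bar>)"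
        using bound by (auto intro: order_trans)
    qed
    then have "convergent (\<lambda>n. (\<Sum>k<n. \<delta> k j) + \<mu> 0 j)"
      by (simp add: summable_iff_convergent convergent_add_const_right_iff)
    moreover have "(\<Sum>k<n. \<delta> k j) + \<mu> 0 j = \<mu> n j" for n
      using sum_lessThan_telescope[of "\<lambda>k. \<mu> k j" n] by (simp add: \<delta>_def)
    ultimately show ?thesis by simp
  qed
  then obtain x where x: "\<And>j. j \<in> A \<Longrightarrow> (\<lambda>n. \<mu> n j) \<longlonglongrightarrow> x j"
    unfolding convergent_def by metis
  have stat: "(\<Sum>i\<in>A. x i * P i j) = x j" if "j \<in> A" for j
  proof (rule LIMSEQ_unique)
    show "(\<lambda>n. \<mu> (Suc n) j) \<longlonglongrightarrow> (\<Sum>i\<in>A. x i * P i j)"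
      unfolding \<mu>Suc by (intro tendsto_intros x)
    show "(\<lambda>n. \<mu> (Suc n) j) \<longlonglongrightarrow> x j"
      using x[OF that] by (rule LIMSEQ_Suc)
  qed
  have x1: "sum x A = 1"
  proof (rule LIMSEQ_unique)
    show "(\<lambda>n. sum (\<mu> n) A) \<longlonglongrightarrow> sum x A"
      by (intro tendsto_sum x)
  qed (simp add: sum1)
  have x0: "0 \<le> x j" if "j \<in> A" for j
    using x[OF that] nonneg[OF that] by (intro LIMSEQ_le_const) auto
  have "x j > 0" if j: "j \<in> A" for j
  proof -
    \<comment> \<open>Some coordinate carries mass since the total is 1. All entries of
      \<open>P\<close> being positive, one step of the chain spreads this mass to every
      \<open>j\<close>, and that step fixes \<open>x\<close>.\<close>
    obtain i where "i \<in> A" "x i \<noteq> 0"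
      using x1 by (metis sum.neutral zero_neq_one)
    then have "0 < (\<Sum>i\<in>A. x i * P i j)"
      using x0 j pos fin by (intro sum_pos2[of _ i]) (auto simp: less_le)
    then show ?thesis
      using stat[OF j] by simp
  qed
  with x1 stat show ?thesis
    by blast
qed

end

section \<open>Invariant laws of the maximal branching process\<close>

lemma laws_pmf:
  assumes "p \<in> laws N"
  shows "k \<in> {1..N} \<Longrightarrow> pmf p k > 0" "k \<notin> {1..N} \<Longrightarrow> pmf p k = 0"
  using assms by (auto simp: laws_def pmf_positive_iff set_pmf_iff)

lemma laws_pmf_sum: "p \<in> laws N \<Longrightarrow> (\<Sum>k=1..N. pmf p k) = 1"
  by (auto simp: laws_def intro!: sum_pmf_eq_1)

lemma laws_dist_fun:
  assumes "p \<in> laws N"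
  shows "dist_fun p j = (\<Sum>k=1..j. pmf p k)"
proof -
  have "dist_fun p j = (\<Sum>k\<le>j. pmf p k)"
    by (simp add: dist_fun_def measure_measure_pmf_finite)
  also have "\<dots> = (\<Sum>k=1..j. pmf p k)"
    using laws_pmf(2)[OF assms, of 0] by (simp add: sum.atMost_shift sum.atLeast1_atMost_eq)
  finally show ?thesis .
qed

lemma laws_dist_fun_0: "p \<in> laws N \<Longrightarrow> dist_fun p 0 = 0"
  and laws_dist_fun_N: "p \<in> laws N \<Longrightarrow> dist_fun p N = 1"
  by (simp_all add: laws_dist_fun laws_pmf_sum del: One_nat_def)

lemma laws_dist_fun_Suc: "p \<in> laws N \<Longrightarrow> dist_fun p (Suc j) = dist_fun p j + pmf p (Suc j)"
  by (simp add: laws_dist_fun)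

lemma dist_fun_unit: "dist_fun p j \<in> {0..1}"
  by (simp add: dist_fun_def)

lemma dist_fun_less:
  assumes "p \<in> laws N" "j < N"
  shows "dist_fun p j < dist_fun p (Suc j)"
  using laws_pmf(1)[OF assms(1), of "Suc j"] assms(2) by (simp add: laws_dist_fun_Suc[OF assms(1)])

lemma laws_eqI:
  assumes "p \<in> laws N" "q \<in> laws N" "\<And>j. j \<in> {1..N} \<Longrightarrow> dist_fun p j = dist_fun q j"
  shows "p = q"
proof (rule pmf_eqI)
  fix k show "pmf p k = pmf q k"
  proof (cases "k \<in> {1..N}")
    case True
    then obtain j where k: "k = Suc j" "j < N"
      by (cases k) auto
    have "dist_fun p i = dist_fun q i" if "i \<le> N" for i
      using assms that by (cases i) (auto simp: laws_dist_fun_0)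
    then show ?thesis
      using laws_dist_fun_Suc[OF assms(1), of j] laws_dist_fun_Suc[OF assms(2), of j] k by simp
  qed (use assms in \<open>simp add: laws_pmf(2)\<close>)
qed

lemma ex_law_dist_fun:
  assumes F0: "F 0 = 0" and FN: "F N = 1" and mono: "\<And>j. j < N \<Longrightarrow> F j < F (Suc j)"
  shows "\<exists>q\<in>laws N. \<forall>j\<in>{1..N}. dist_fun q j = F j"
proof -
  have tel: "(\<Sum>k=1..j. F k - F (k - 1)) = F j" for j
    by (induction j) (simp_all add: F0)
  \<comment> \<open>Strict increase makes each mass positive, so that the support is all of
    \<open>{1..N}\<close>.\<close>
  have "F k - F (k - 1) > 0" if "k \<in> {1..N}" for k
    using mono[of "k - 1"] that by auto
  then obtain q where q: "set_pmf q = {1..N}" "\<And>k. k \<in> {1..N} \<Longrightarrow> pmf q k = F k - F (k - 1)"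
    using ex_pmf_finite_support[of "{1..N}" "\<lambda>k. F k - F (k - 1)"] tel[of N] FN by auto
  then have "q \<in> laws N"
    by (simp add: laws_def)
  moreover have "dist_fun q j = F j" if "j \<in> {1..N}" for j
  proof -
    have "dist_fun q j = (\<Sum>k=1..j. F k - F (k - 1))"
      unfolding laws_dist_fun[OF \<open>q \<in> laws N\<close>] using that by (intro sum.cong refl q) auto
    then show ?thesis by (simp only: tel)
  qed
  ultimately show ?thesis by blast
qed

section \<open>The polynomial \<open>Phi\<close> on the unit interval and the law of nu\<close>

lemma poly_Phi: "poly (Phi N p) x = (\<Sum>k=1..N. pmf p k * x ^ k)"
  by (simp add: Phi_def poly_sum poly_monom)

lemma poly_Phi_0: "poly (Phi N p) 0 = 0"
  by (simp add: poly_Phi)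

lemma poly_Phi_1: "p \<in> laws N \<Longrightarrow> poly (Phi N p) 1 = 1"
  by (simp add: poly_Phi laws_pmf_sum del: One_nat_def)

lemma pderiv_sum: "pderiv (\<Sum>i\<in>A. f i) = (\<Sum>i\<in>A. pderiv (f i))"
  by (induction A rule: infinite_finite_induct) (simp_all add: pderiv_add)

lemma pderiv_Phi_pos:
  assumes "p \<in> laws N" "N \<ge> 1" "x \<ge> 0"
  shows "poly (pderiv (Phi N p)) x > 0"
proof -
  have "poly (pderiv (Phi N p)) x = (\<Sum>k=1..N. real k * pmf p k * x ^ (k - 1))"
    by (simp add: Phi_def pderiv_sum poly_sum pderiv_monom poly_monom)
  also have "\<dots> > 0"
    using assms laws_pmf(1)[OF assms(1)] by (intro sum_pos2[of _ 1]) auto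
  finally show ?thesis .
qed

lemma poly_Phi_less:
  assumes "p \<in> laws N" "N \<ge> 1" "0 \<le> x" "x < y"
  shows "poly (Phi N p) x < poly (Phi N p) y"
  using assms by (intro poly_less_if_pderiv_pos pderiv_Phi_pos) auto

lemma poly_Phi_eq_iff:
  assumes "p \<in> laws N" "N \<ge> 1" "0 \<le> x" "0 \<le> y"
  shows "poly (Phi N p) x = poly (Phi N p) y \<longleftrightarrow> x = y"
  using poly_Phi_less[OF assms(1,2)] assms(3,4) by (metis less_irrefl linorder_neqE_linordered_idom)

lemma ex_poly_Phi_eq:
  assumes "p \<in> laws N" "y \<in> {0..1}"
  shows "\<exists>x\<in>{0..1}. poly (Phi N p) x = y"
proof -
  have "\<exists>x\<ge>0. x \<le> 1 \<and> poly (Phi N p) x = y"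
    by (rule IVT') (use assms in \<open>auto simp: poly_Phi_0 poly_Phi_1 intro: continuous_intros\<close>)
  then show ?thesis by auto
qed

text \<open>The distribution function of \<open>q\<close> has to be the preimage of that of
  \<open>p\<close> under the increasing bijection \<open>Phi\<close> of [0,1]. This preimage runs
  from 0 to 1 and inherits strict increase, so it does come from a law with full support.\<close>

lemma ex1_nu_of:
  assumes p: "p \<in> laws N" and N: "N \<ge> 1"
  shows "\<exists>!q. q \<in> laws N \<and> nu_of N p q"
proof -
  have "\<exists>x\<in>{0..1}. poly (Phi N p) x = dist_fun p j" for j
    using ex_poly_Phi_eq[OF p dist_fun_unit] .
  then obtain F where F: "\<And>j. F j \<in> {0..1}" "\<And>j. poly (Phi N p) (F j) = dist_fun p j"
    by metis
  have "F 0 = 0"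
    using poly_Phi_eq_iff[OF p N, of "F 0" 0] F[of 0] by (simp add: poly_Phi_0 laws_dist_fun_0[OF p])
  moreover have "F N = 1"
    using poly_Phi_eq_iff[OF p N, of "F N" 1] F[of N] by (simp add: poly_Phi_1 p laws_dist_fun_N[OF p])
  moreover have "F j < F (Suc j)" if "j < N" for j
  proof (rule ccontr)
    assume "\<not> ?thesis"
    then have "poly (Phi N p) (F (Suc j)) \<le> poly (Phi N p) (F j)"
      using poly_Phi_less[OF p N, of "F (Suc j)" "F j"] F(1)[of "Suc j"]
      by (cases "F (Suc j) = F j") auto
    then show False
      using dist_fun_less[OF p that] by (simp add: F(2))
  qed
  ultimately obtain q where q: "q \<in> laws N" "\<And>j. j \<in> {1..N} \<Longrightarrow> dist_fun q j = F j"
    using ex_law_dist_fun by blast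
  show ?thesis
  proof (rule ex1I[of _ q])
    show "q \<in> laws N \<and> nu_of N p q"
      using q F(2) by (simp add: nu_of_def)
    fix r assume r: "r \<in> laws N \<and> nu_of N p r"
    show "r = q"
    proof (rule laws_eqI)
      fix j assume j: "j \<in> {1..N}"
      have "poly (Phi N p) (dist_fun r j) = poly (Phi N p) (dist_fun q j)"
        using r q(2)[OF j] F(2)[of j] j by (simp add: nu_of_def)
      then show "dist_fun r j = dist_fun q j"
        using poly_Phi_eq_iff[OF p N] dist_fun_unit by auto
    qed (use r q in auto)
  qed
qed

lemma nu_law_props:
  assumes "p \<in> laws N" "N \<ge> 1"
  shows "nu_law N p \<in> laws N" "nu_of N p (nu_law N p)"
  using theI'[OF ex1_nu_of[OF assms]] by (simp_all add: nu_law_def)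

text \<open>Taking differences in j of F(j) = Phi(G(j)) gives the stationarity equations. Here
  G(j)^i - G(j-1)^i is the probability that the maximum of i independent variables of law
  \<open>q\<close> equals j, the transition probability of the maximal branching process.\<close>

lemma nu_of_iff_stationary:
  assumes p: "p \<in> laws N" and q: "q \<in> laws N"
  shows "nu_of N p q \<longleftrightarrow>
    (\<forall>j\<in>{1..N}. (\<Sum>i=1..N. pmf p i * (dist_fun q j ^ i - dist_fun q (j - 1) ^ i)) = pmf p j)"
    (is "_ \<longleftrightarrow> ?stat")
proof -
  let ?\<Phi> = "\<lambda>j. poly (Phi N p) (dist_fun q j)"
  have inc: "(\<Sum>i=1..N. pmf p i * (dist_fun q j ^ i - dist_fun q (j - 1) ^ i)) = ?\<Phi> j - ?\<Phi> (j - 1)"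
    for j
    by (simp add: poly_Phi right_diff_distrib sum_subtractf)
  \<comment> \<open>\<open>nu_of\<close> says nothing at j = 0; both sides vanish there, which
    anchors the telescoping.\<close>
  have zero: "?\<Phi> 0 = 0" "dist_fun p 0 = 0"
    using p q by (simp_all add: laws_dist_fun_0 poly_Phi_0)
  have pmf: "pmf p j = dist_fun p j - dist_fun p (j - 1)" if "j \<in> {1..N}" for j
    using laws_dist_fun_Suc[OF p, of "j - 1"] that by simp
  show ?thesis
  proof
    assume "nu_of N p q"
    then have "dist_fun p j = ?\<Phi> j" if "j \<le> N" for j
      using that zero by (cases j) (auto simp: nu_of_def)
    then show ?stat
      unfolding inc by (auto simp: pmf simp del: One_nat_def)
  next
    assume ?stat
    then have step: "?\<Phi> j - ?\<Phi> (j - 1) = dist_fun p j - dist_fun p (j - 1)" if "j \<in> {1..N}" for j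
      using bspec[OF \<open>?stat\<close> that] pmf[OF that] unfolding inc by linarith
    have "dist_fun p j = ?\<Phi> j" if "j \<le> N" for j
      using that
    proof (induction j)
      case (Suc j)
      then show ?case
        using step[of "Suc j"] by simp
    qed (simp add: zero)
    then show "nu_of N p q"
      by (simp add: nu_of_def)
  qed
qed

text \<open>A law is mapped to \<open>q\<close> exactly when it is stationary for the chain
  \<open>P q\<close>. The entries of this chain are positive, so a stationary law with full support
  exists (onto) and there is no second one (one-to-one).\<close>

lemma bij_betw_nu_law:
  assumes N: "N \<ge> 1"
  shows "bij_betw (nu_law N) (laws N) (laws N)"
proof -
  define P where "P q i j = dist_fun q j ^ i - dist_fun q (j - 1) ^ i" for q and i j :: nat
  have pos: "P q i j > 0" if "q \<in> laws N" "i \<in> {1..N}" "j \<in> {1..N}" for q i j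
    using dist_fun_less[OF that(1), of "j - 1"] that dist_fun_unit[of q "j - 1"]
    by (auto simp: P_def intro!: power_strict_mono)
  have stoch: "(\<Sum>j=1..N. P q i j) = 1" if "q \<in> laws N" "i \<in> {1..N}" for q i
  proof -
    \<comment> \<open>The row telescopes, and its starting value \<open>dist_fun q 0 ^ i\<close> is
      0 because i is at least 1.\<close>
    have "(\<Sum>j=1..m. P q i j) = dist_fun q m ^ i" for m
      using that by (induction m) (simp_all add: P_def laws_dist_fun_0)
    then show ?thesis
      using that by (simp add: laws_dist_fun_N)
  qed
  have fin: "finite {1..N}" "{1..N} \<noteq> {}"
    using N by auto
  have stat: "nu_of N p q \<longleftrightarrow> (\<forall>j\<in>{1..N}. (\<Sum>i=1..N. pmf p i * P q i j) = pmf p j)"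
    if "p \<in> laws N" "q \<in> laws N" for p q
    using nu_of_iff_stationary[OF that] by (simp add: P_def)
  have "inj_on (nu_law N) (laws N)"
  proof (rule inj_onI)
    fix p p' assume p: "p \<in> laws N" "p' \<in> laws N" "nu_law N p = nu_law N p'"
    define q where "q = nu_law N p"
    have q: "q \<in> laws N" "nu_of N p q" "nu_of N p' q"
      using nu_law_props[OF p(1) N] nu_law_props[OF p(2) N] p(3) by (simp_all add: q_def)
    have "pmf p j = pmf p' j" if "j \<in> {1..N}" for j
      by (rule stationary_distribution_unique[where P = "P q", OF fin pos[OF q(1)] stoch[OF q(1)]])
        (use p q stat that in \<open>auto simp: laws_pmf_sum simp del: One_nat_def\<close>)
    then show "p = p'"
      using p by (metis laws_pmf(2) pmf_eqI)
  qed
  moreover have "q \<in> nu_law N ` laws N" if q: "q \<in> laws N" for q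
  proof -
    obtain x where x: "\<And>j. j \<in> {1..N} \<Longrightarrow> x j > 0" "sum x {1..N} = 1"
      "\<And>j. j \<in> {1..N} \<Longrightarrow> (\<Sum>i=1..N. x i * P q i j) = x j"
      using stationary_distribution_exists[where P = "P q", OF fin pos[OF q] stoch[OF q]] by blast
    obtain p where p: "set_pmf p = {1..N}" "\<And>j. j \<in> {1..N} \<Longrightarrow> pmf p j = x j"
      using ex_pmf_finite_support[of "{1..N}" x] x by auto
    have pl: "p \<in> laws N"
      using p by (simp add: laws_def)
    have "nu_of N p q"
      using x(3) p(2) by (simp add: stat[OF pl q])
    then have "nu_law N p = q"
      using ex1_nu_of[OF pl N] nu_law_props[OF pl N] q by blast
    then show ?thesis
      using pl by blast
  qed
  ultimately show ?thesis
    using nu_law_props(1)[OF _ N] by (auto simp: bij_betw_def)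
qed

section \<open>The coefficients of the inverse series\<close>

lemma C_coeff_eq:
  "C_coeff p M a k = ((\<Sum>m=1..M. fps_const (pmf p (m + 1) / pmf p 1) * fps_X ^ m) ^ k) $ a / fact k"
proof (cases "k = 0")
  case False
  let ?r = "\<lambda>m. pmf p (m + 1) / pmf p 1"
  let ?S = "{\<kappa>::nat \<Rightarrow> nat. \<kappa> \<in> {1..M} \<rightarrow>\<^sub>E UNIV \<and> sum \<kappa> {1..M} = k}"
  have fin: "finite ?S"
  proof (rule finite_subset)
    show "?S \<subseteq> {1..M} \<rightarrow>\<^sub>E {..k}"
      by (auto simp: PiE_iff extensional_def intro!: member_le_sum)
  qed (auto intro: finite_PiE)
  have idx: "C_index M a k = {\<kappa> \<in> ?S. a = (\<Sum>m=1..M. m * \<kappa> m)}"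
  proof -
    have "sum \<kappa> {1..M} \<le> (\<Sum>m=1..M. m * \<kappa> m)" for \<kappa> :: "nat \<Rightarrow> nat"
      by (intro sum_mono) auto
    then show ?thesis
      by (auto simp: C_index_def)
  qed
  \<comment> \<open>Each family in the multinomial expansion gives one monomial, whose degree is its
    weighted sum. Extracting degree \<open>a\<close> therefore leaves exactly the sum over
    \<open>C_index\<close>.\<close>
  have "(\<Prod>m=1..M. fps_const (1 / fact (\<kappa> m)) * (fps_const (?r m) * fps_X ^ m) ^ \<kappa> m) =
      fps_const (\<Prod>m=1..M. ?r m ^ \<kappa> m / fact (\<kappa> m)) * fps_X ^ (\<Sum>m=1..M. m * \<kappa> m)" for \<kappa>
    by (simp add: power_mult_distrib fps_const_power prod.distrib power_sum power_mult prod_dividef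
        flip: fps_const_prod)
  then have "(\<Prod>m=1..M. fps_const (1 / fact (\<kappa> m)) * (fps_const (?r m) * fps_X ^ m) ^ \<kappa> m) $ a =
      (if a = (\<Sum>m=1..M. m * \<kappa> m) then \<Prod>m=1..M. ?r m ^ \<kappa> m / fact (\<kappa> m) else 0)" for \<kappa>
    by simp
  then have "(fps_const (1 / fact k) * (\<Sum>m=1..M. fps_const (?r m) * fps_X ^ m) ^ k) $ a =
      (\<Sum>\<kappa>\<in>?S. if a = (\<Sum>m=1..M. m * \<kappa> m) then \<Prod>m=1..M. ?r m ^ \<kappa> m / fact (\<kappa> m) else 0)"
    by (simp only: fps_multinomial_exp_form finite_atLeastAtMost fps_sum_nth)
  also have "\<dots> = C_coeff p M a k"
    unfolding C_coeff_def idx sum.inter_filter[OF fin] using False by simp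
  finally show ?thesis
    by simp
qed (simp add: C_coeff_def)

text \<open>Normalises the constant term to 1, so that powers of the inverse can be expanded by the
  binomial series; the ratios that appear are those in \<open>C_coeff\<close>.\<close>

lemma fps_of_poly_Psi:
  assumes p: "p \<in> laws N" and N: "N \<ge> 1"
  shows "fps_of_poly (Psi N p) =
    fps_const (pmf p 1) * (1 + (\<Sum>m=1..N - 1. fps_const (pmf p (m + 1) / pmf p 1) * fps_X ^ m))"
proof (rule fps_ext)
  fix n
  have p1: "pmf p 1 > 0"
    using laws_pmf(1)[OF p, of 1] N by simp
  have "coeff (Psi N p) n = (\<Sum>k=1..N. if k = Suc n then pmf p k else 0)"
    unfolding Psi_def coeff_sum by (intro sum.cong) (auto simp: coeff_monom)
  then have 1: "coeff (Psi N p) n = pmf p (Suc n)"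
    using laws_pmf(2)[OF p, of "Suc n"] by (auto simp: sum.delta)
  have "(\<Sum>m=1..N - 1. fps_const (pmf p (m + 1) / pmf p 1) * fps_X ^ m) $ n =
      (\<Sum>m=1..N - 1. if m = n then pmf p (m + 1) / pmf p 1 else 0)"
    unfolding fps_sum_nth by (intro sum.cong) auto
  then have 2: "(\<Sum>m=1..N - 1. fps_const (pmf p (m + 1) / pmf p 1) * fps_X ^ m) $ n =
      (if n = 0 then 0 else pmf p (Suc n) / pmf p 1)"
    using laws_pmf(2)[OF p, of "Suc n"] N by (auto simp: sum.delta)
  show "fps_of_poly (Psi N p) $ n = (fps_const (pmf p 1) *
      (1 + (\<Sum>m=1..N - 1. fps_const (pmf p (m + 1) / pmf p 1) * fps_X ^ m))) $ n"
    using p1 unfolding fps_of_poly_nth 1 fps_mult_left_const_nth fps_add_nth 2 by simp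
qed

lemma inverse_Psi_power_nth:
  assumes p: "p \<in> laws N" and N: "N \<ge> 1"
  shows "(inverse (fps_of_poly (Psi N p)) ^ n) $ a =
    inverse (pmf p 1) ^ n *
      (\<Sum>k=0..a. (-1) ^ k * pochhammer (real n) k * C_coeff p (N - 1) a k)"
proof -
  define u where "u = (\<Sum>m=1..N - 1. fps_const (pmf p (m + 1) / pmf p 1) * fps_X ^ m)"
  have u0: "u $ 0 = 0"
    by (simp add: u_def fps_sum_nth)
  have "inverse (fps_of_poly (Psi N p)) ^ n = fps_const (inverse (pmf p 1) ^ n) * inverse (1 + u) ^ n"
    unfolding fps_of_poly_Psi[OF assms] u_def[symmetric] fps_inverse_mult fps_const_inverse
      power_mult_distrib fps_const_power ..
  then show ?thesis
    by (simp add: fps_one_plus_inverse_power_nth[OF u0] C_coeff_eq flip: u_def del: One_nat_def)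
qed

lemma fps_inv_Phi_nth:
  assumes p: "p \<in> laws N" and N: "N \<ge> 1" and n: "n \<ge> 1"
  shows "fps_inv (fps_of_poly (Phi N p)) $ n =
    1 / real n * (inverse (fps_of_poly (Psi N p)) ^ n) $ (n - 1)"
proof -
  have "pmf p 1 > 0"
    using laws_pmf(1)[OF p, of 1] N by simp
  then have "fps_of_poly (Psi N p) $ 0 \<noteq> 0"
    unfolding fps_of_poly_Psi[OF p N] by (simp add: fps_sum_nth)
  then have "real n * fps_inv (fps_X * fps_of_poly (Psi N p)) $ n =
      (inverse (fps_of_poly (Psi N p)) ^ n) $ (n - 1)"
    using n by (intro lagrange_inversion) auto
  moreover have "fps_of_poly (Phi N p) = fps_X * fps_of_poly (Psi N p)"
    by (simp add: Phi_eq_X_times_Psi fps_of_poly_mult fps_of_poly_pCons)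
  ultimately show ?thesis
    using n by (simp only: eq_divide_eq times_divide_eq_left) (simp add: field_simps)
qed

text \<open>The factor \<open>pmf p 1 ^ n\<close> cancels the negative power in the Lagrange
  coefficients: \<open>h_coeff\<close> lists the coefficients of the inverse of \<open>Phi\<close>
  evaluated at \<open>pmf p 1\<close> times the variable.\<close>

lemma h_coeff_eq:
  assumes p: "p \<in> laws N" and N: "N \<ge> 1"
  shows "h_coeff N p n = pmf p 1 ^ n * fps_inv (fps_of_poly (Phi N p)) $ n"
proof (cases "n = 0")
  case True
  then show ?thesis by (simp add: h_coeff_def fps_inv_def)
next
  case False
  let ?t = "\<lambda>k. (-1) ^ k * pochhammer (real n) k * C_coeff p (N - 1) (n - 1) k"
  have p1: "pmf p 1 > 0"
    using laws_pmf(1)[OF p, of 1] N by simp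
  have "pmf p 1 ^ n * fps_inv (fps_of_poly (Phi N p)) $ n = 1 / real n * (\<Sum>k=0..n-1. ?t k)"
    using False p1 
    by (simp add: fps_inv_Phi_nth[OF p N] inverse_Psi_power_nth[OF p N] power_inverse)
  also have "\<dots> = h_coeff N p n"
  proof (cases "n = 1")
    case True
    then show ?thesis by (simp add: h_coeff_def C_coeff_def)
  next
    case False
    \<comment> \<open>By the Kronecker symbol in \<open>C_coeff\<close> the term
      \<open>k = 0\<close> vanishes for n at least 2; for n = 1 it is the whole sum and gives the
      value 1.\<close>
    then have "(\<Sum>k=0..n-1. ?t k) = (\<Sum>k=1..n-1. ?t k)"
      using \<open>n \<noteq> 0\<close> by (simp add: sum.atLeast_Suc_atMost[of 0] C_coeff_def)
    then show ?thesis
      using False \<open>n \<noteq> 0\<close> by (simp add: h_coeff_def)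
  qed
  finally show ?thesis ..
qed

text \<open>The unique existence stated first makes the definite description \<open>nu_law\<close>
  meaningful. Since the series may diverge, as for N = 2 with equal masses and j = 1, its value is
  given by analytic continuation of the germ at 0; whenever it converges, the ordinary sum is the
  same.\<close>

theorem proposition8:
  fixes N :: nat
  assumes "N \<ge> 2"
  shows
    "(\<forall>p\<in>laws N. \<exists>!q. q \<in> laws N \<and> nu_of N p q) \<and>
     bij_betw (nu_law N) (laws N) (laws N) \<and>
     (\<forall>p\<in>laws N. \<forall>n\<ge>1.
        fps_nth (fps_inv (fps_of_poly (Phi N p))) n =
          1 / real n * fps_nth (inverse (fps_of_poly (Psi N p)) ^ n) (n - 1) \<and>
        1 / real n * fps_nth (inverse (fps_of_poly (Psi N p)) ^ n) (n - 1) =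
          inverse (pmf p 1) ^ n / real n *
            (\<Sum>k=0..n-1. (-1) ^ k * pochhammer (real n) k * C_coeff p (N - 1) (n - 1) k)) \<and>
     (\<forall>p\<in>laws N. \<forall>j\<in>{1..N}.
        continued_sum (h_coeff N p) (dist_fun p j / pmf p 1) (dist_fun (nu_law N p) j) \<and>
        (summable (\<lambda>n. h_coeff N p (Suc n) * (dist_fun p j / pmf p 1) ^ Suc n) \<longrightarrow>
         (\<lambda>n. h_coeff N p (Suc n) * (dist_fun p j / pmf p 1) ^ Suc n)
           sums dist_fun (nu_law N p) j))"
proof (intro conjI ballI allI impI)
  have N: "N \<ge> 1"
    using assms by simp
  show "bij_betw (nu_law N) (laws N) (laws N)"
    using N by (rule bij_betw_nu_law)
  fix p assume p: "p \<in> laws N"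
  show "\<exists>!q. q \<in> laws N \<and> nu_of N p q"
    using p N by (rule ex1_nu_of)
  show "fps_nth (fps_inv (fps_of_poly (Phi N p))) n =
      1 / real n * fps_nth (inverse (fps_of_poly (Psi N p)) ^ n) (n - 1)" if "n \<ge> 1" for n
    using p N that by (rule fps_inv_Phi_nth)
  show "1 / real n * fps_nth (inverse (fps_of_poly (Psi N p)) ^ n) (n - 1) =
      inverse (pmf p 1) ^ n / real n *
        (\<Sum>k=0..n-1. (-1) ^ k * pochhammer (real n) k * C_coeff p (N - 1) (n - 1) k)" for n
    by (simp add: inverse_Psi_power_nth[OF p N])
  fix j assume j: "j \<in> {1..N}"
  let ?y = "dist_fun (nu_law N p) j"
  have Phi: "dist_fun p j = poly (Phi N p) ?y"
    using nu_law_props(2)[OF p N] j by (simp add: nu_of_def)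
  have p1: "pmf p 1 > 0"
    using laws_pmf(1)[OF p, of 1] N by simp
  have h: "h_coeff N p = (\<lambda>n. pmf p 1 ^ n * fps_inv (fps_of_poly (Phi N p)) $ n)"
    using h_coeff_eq[OF p N] by blast
  have pos: "poly (pderiv (Phi N p)) x > 0" if "x \<in> {0..1}" for x
    using that by (intro pderiv_Phi_pos p N) simp
  show "continued_sum (h_coeff N p) (dist_fun p j / pmf p 1) ?y"
    unfolding h Phi by (intro continued_sum_inverse_poly poly_Phi_0 pos dist_fun_unit p1)
  \<comment> \<open>The stated series starts at index 1 and \<open>sums_inverse_poly\<close> at
    index 0; the vanishing term reconciles the two.\<close>
  have h0: "h_coeff N p 0 = 0"
    by (simp add: h_coeff_def)
  show "(\<lambda>n. h_coeff N p (Suc n) * (dist_fun p j / pmf p 1) ^ Suc n) sums ?y"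
    if "summable (\<lambda>n. h_coeff N p (Suc n) * (dist_fun p j / pmf p 1) ^ Suc n)"
  proof -
    have "summable (\<lambda>n. h_coeff N p n * (dist_fun p j / pmf p 1) ^ n)"
      using that by (subst (asm) summable_Suc_iff)
    then have "(\<lambda>n. h_coeff N p n * (dist_fun p j / pmf p 1) ^ n) sums ?y"
      unfolding Phi by (intro sums_inverse_poly poly_Phi_0 pos dist_fun_unit p1 h)
    then show ?thesis
      by (subst sums_Suc_iff) (simp add: h0)
  qed
qed

end
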